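(* Let $\mathbf{A}=[a_{ij}]$ be an $n\times n$ pairwise comparison matrix and $\mathbf{w}=(w_1,\dots,w_n)^{\top}$ a positive weight vector. Let $I=\{(i,j)\mid a_{ij}<w_i/w_j\}$ and $J=\{(i,j)\mid a_{ij}=w_i/w_j,\ i<j\}$, and assume $I\neq\emptyset$. Put $v_i=\log w_i$ for $1\le i\le n$ and $b_{ij}=\log a_{ij}$ for $1\le i,j\le n$. Consider the linear program in the variables $y_i\in\mathbb{R}$ ($1\le i\le n$) and $s_{ij}$ ($(i,j)\in I$): \begin{align*} \min \sum_{(i,j)\in I} -s_{ij}&\\ y_j-y_i&\le -b_{ij} &&\text{for all }(i,j)\in I,\\ y_i-y_j+s_{ij}&\le v_i-v_j &&\text{for all }(i,j)\in I,\\ y_i-y_j&=b_{ij} &&\text{for all }(i,j)\in J,\\ s_{ij}&\ge 0 &&\text{for all }(i,j)\in I,\\ y_1&=0. \end{align*} The optimum value of this linear program is at most $0$, and it is equal to $0$ if and only if $\mathbf{w}$ is efficient with respect to $\mathbf{A}$. Moreover, let $(\mathbf{y}^{\ast},\mathbf{s}^{\ast})\in\mathbb{R}^{n+|I|}$ be an optimal solution; if $\mathbf{w}$ is inefficient, then the weight vector $\exp(\mathbf{y}^{\ast})=(e^{y_1^{\ast}},\dots,e^{y_n^{\ast}})^{\top}$ is efficient and dominates $\mathbf{w}$ internally.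
   Context: A pairwise comparison matrix of size $n\times n$ ($n\ge 3$) is a real matrix $\mathbf{A}=[a_{ij}]$ with all entries positive and $a_{ij}=1/a_{ji}$ for all $1\le i,j\le n$. A positive weight vector $\mathbf{w}$ is called efficient (with respect to $\mathbf{A}$) if there is no positive vector $\mathbf{w}'$ such that $|a_{ij}-w'_i/w'_j|\le|a_{ij}-w_i/w_j|$ for all $1\le i,j\le n$ and $|a_{k\ell}-w'_k/w'_\ell|<|a_{k\ell}-w_k/w_\ell|$ for some $1\le k,\ell\le n$. It is called inefficient if it is not efficient. A positive vector $\mathbf{w}'$ dominates $\mathbf{w}$ internally if (i) for all $1\le i,j\le n$: $a_{ij}\le w_i/w_j$ implies $a_{ij}\le w'_i/w'_j\le w_i/w_j$, and $a_{ij}\ge w_i/w_j$ implies $a_{ij}\ge w'_i/w'_j\ge w_i/w_j$; and (ii) for some $1\le k,\ell\le n$ both implications hold: $a_{k\ell}\le w_k/w_\ell$ implies $w'_k/w'_\ell<w_k/w_\ell$, and $a_{k\ell}\ge w_k/w_\ell$ implies $w'_k/w'_\ell>w_k/w_\ell$. *)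

theory Defs
  imports "HOL-Analysis.Analysis"
begin

text \<open>The index set \<open>{1, \<dots>, n}\<close> is a type \<open>'n\<close> of class \<open>{finite, linorder}\<close> with
  \<open>n = CARD('n)\<close>; the order matters only for \<open>i < j\<close> in \<open>tie_set\<close> and for the index \<open>1\<close>,
  which is \<open>Min UNIV\<close>.\<close>

definition pairwise_comparison_matrix :: "real^'n^'n \<Rightarrow> bool" where
  "pairwise_comparison_matrix A \<longleftrightarrow>
     CARD('n) \<ge> 3 \<and> (\<forall>i j. A $ i $ j > 0) \<and> (\<forall>i j. A $ i $ j = 1 / A $ j $ i)"

definition positive_vector :: "real^'n \<Rightarrow> bool" where
  "positive_vector w \<longleftrightarrow> (\<forall>i. w $ i > 0)"

definition dominates :: "real^'n^'n \<Rightarrow> real^'n \<Rightarrow> real^'n \<Rightarrow> bool" where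
  "dominates A w' w \<longleftrightarrow>
     (\<forall>i j. \<bar>A $ i $ j - w' $ i / w' $ j\<bar> \<le> \<bar>A $ i $ j - w $ i / w $ j\<bar>) \<and>
     (\<exists>k l. \<bar>A $ k $ l - w' $ k / w' $ l\<bar> < \<bar>A $ k $ l - w $ k / w $ l\<bar>)"

definition efficient :: "real^'n^'n \<Rightarrow> real^'n \<Rightarrow> bool" where
  "efficient A w \<longleftrightarrow> positive_vector w \<and> \<not> (\<exists>w'. positive_vector w' \<and> dominates A w' w)"

definition inefficient :: "real^'n^'n \<Rightarrow> real^'n \<Rightarrow> bool" where
  "inefficient A w \<longleftrightarrow> positive_vector w \<and> \<not> efficient A w"

text \<open>In the second conjunct both implications are required of the same pair \<open>(k, l)\<close>, which
  excludes \<open>A $ k $ l = w $ k / w $ l\<close>.\<close>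

definition dominates_internally :: "real^'n^'n \<Rightarrow> real^'n \<Rightarrow> real^'n \<Rightarrow> bool" where
  "dominates_internally A w' w \<longleftrightarrow>
     positive_vector w' \<and>
     (\<forall>i j.
        (A $ i $ j \<le> w $ i / w $ j \<longrightarrow>
           A $ i $ j \<le> w' $ i / w' $ j \<and> w' $ i / w' $ j \<le> w $ i / w $ j) \<and>
        (A $ i $ j \<ge> w $ i / w $ j \<longrightarrow>
           A $ i $ j \<ge> w' $ i / w' $ j \<and> w' $ i / w' $ j \<ge> w $ i / w $ j)) \<and>
     (\<exists>k l.
        (A $ k $ l \<le> w $ k / w $ l \<longrightarrow> w' $ k / w' $ l < w $ k / w $ l) \<and>
        (A $ k $ l \<ge> w $ k / w $ l \<longrightarrow> w' $ k / w' $ l > w $ k / w $ l))"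

definition above_set :: "real^'n^'n \<Rightarrow> real^'n \<Rightarrow> ('n \<times> 'n) set" where
  "above_set A w = {(i, j). A $ i $ j < w $ i / w $ j}"

definition tie_set ::
    "real^('n::{finite,linorder})^('n::{finite,linorder}) \<Rightarrow> 
     real^('n::{finite,linorder}) \<Rightarrow> ('n \<times> 'n) set" where
  "tie_set A w = {(i, j). A $ i $ j = w $ i / w $ j \<and> i < j}"

text \<open>The linear program, with \<open>v\<^sub>i = ln (w $ i)\<close> and \<open>b\<^sub>i\<^sub>j = ln (A $ i $ j)\<close>. Its variables
  \<open>s i j\<close> are those with \<open>(i, j) \<in> above_set A w\<close>; other values of \<open>s\<close> occur neither in the
  constraints nor in the objective.\<close>

definition lp_feasible ::
    "real^('n::{finite,linorder})^('n::{finite,linorder}) \<Rightarrow> 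
     real^('n::{finite,linorder}) \<Rightarrow> real^('n::{finite,linorder}) \<Rightarrow> 
     ('n \<Rightarrow> 'n \<Rightarrow> real) \<Rightarrow> bool" where
  "lp_feasible A w y s \<longleftrightarrow>
     (\<forall>(i, j) \<in> above_set A w. y $ j - y $ i \<le> - ln (A $ i $ j)) \<and>
     (\<forall>(i, j) \<in> above_set A w. y $ i - y $ j + s i j \<le> ln (w $ i) - ln (w $ j)) \<and>
     (\<forall>(i, j) \<in> tie_set A w. y $ i - y $ j = ln (A $ i $ j)) \<and>
     (\<forall>(i, j) \<in> above_set A w. s i j \<ge> 0) \<and>
     y $ Min UNIV = 0"

definition lp_objective :: "real^'n^'n \<Rightarrow> real^'n \<Rightarrow> ('n \<Rightarrow> 'n \<Rightarrow> real) \<Rightarrow> real" where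
  "lp_objective A w s = (\<Sum>(i, j) \<in> above_set A w. - s i j)"

definition lp_optimal_solution ::
    "real^('n::{finite,linorder})^('n::{finite,linorder}) \<Rightarrow> 
     real^('n::{finite,linorder}) \<Rightarrow> real^('n::{finite,linorder}) \<Rightarrow> 
     ('n \<Rightarrow> 'n \<Rightarrow> real) \<Rightarrow> bool" where
  "lp_optimal_solution A w y s \<longleftrightarrow>
     lp_feasible A w y s \<and>
     (\<forall>y' s'. lp_feasible A w y' s' \<longrightarrow> lp_objective A w s \<le> lp_objective A w s')"

text \<open>\<open>Inf\<close> on \<open>real\<close> is unspecified for empty or unbounded sets, so \<open>lp_optimum\<close> is
  meaningful only together with the existence of an optimal solution.\<close>

definition lp_optimum ::
    "real^('n::{finite,linorder})^('n::{finite,linorder}) \<Rightarrow> 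
     real^('n::{finite,linorder}) \<Rightarrow> real" where
  "lp_optimum A w = Inf {lp_objective A w s | y s. lp_feasible A w y s}"

end

theory Submission
  imports Defs
begin

text \<open>In logarithmic coordinates the feasible \<open>y\<close> are exactly the vectors whose differences lie
  weakly between those of \<open>b\<close> and of \<open>v\<close>, and the objective measures how far they have moved from
  \<open>v\<close>. Being weakly between is transitive, so a vector that internally dominates \<open>exp y\<close> for
  an optimal \<open>y\<close> would yield a better feasible point. It remains to see that an inefficient vector
  is dominated internally: if \<open>w'\<close> dominates \<open>w\<close>, then every ratio moves from \<open>w\<close> to \<open>w'\<close>
  towards the matrix entry, possibly beyond it, so a short initial piece of the segment from
  \<open>ln w\<close> to \<open>ln w'\<close> consists of internal dominators.\<close>

section \<open>Betweenness in logarithmic coordinates\<close>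

text \<open>Only one direction of comparison is recorded: for a reciprocal matrix the opposite case
  at \<open>(i, j)\<close> is this condition at \<open>(j, i)\<close>. A tie forces the difference
  to stay fixed.\<close>

definition log_between :: "real^'n^'n \<Rightarrow> real^'n \<Rightarrow> real^'n \<Rightarrow> bool" where
  "log_between A v y \<longleftrightarrow>
     (\<forall>i j. ln (A $ i $ j) \<le> v $ i - v $ j \<longrightarrow>
        ln (A $ i $ j) \<le> y $ i - y $ j \<and> y $ i - y $ j \<le> v $ i - v $ j)"

text \<open>Asking for a strict drop on the side above the entry loses nothing, since a strict rise
  at \<open>(k, l)\<close> is a strict drop at \<open>(l, k)\<close>.\<close>

definition log_strictly_between :: "real^'n^'n \<Rightarrow> real^'n \<Rightarrow> real^'n \<Rightarrow> bool" where
  "log_strictly_between A v y \<longleftrightarrow>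
     log_between A v y \<and>
     (\<exists>k l. ln (A $ k $ l) < v $ k - v $ l \<and> y $ k - y $ l < v $ k - v $ l)"

definition ln_vec :: "real^'n \<Rightarrow> real^'n" where
  "ln_vec w = (\<chi> i. ln (w $ i))"

definition exp_vec :: "real^'n \<Rightarrow> real^'n" where
  "exp_vec y = (\<chi> i. exp (y $ i))"

lemma ln_vec_nth [simp]: "ln_vec w $ i = ln (w $ i)"
  by (simp add: ln_vec_def)

lemma exp_vec_nth [simp]: "exp_vec y $ i = exp (y $ i)"
  by (simp add: exp_vec_def)

lemma positive_exp_vec [simp]: "positive_vector (exp_vec y)"
  by (simp add: positive_vector_def)

lemma ln_exp_vec [simp]: "ln_vec (exp_vec y) = y"
  by (simp add: vec_eq_iff)

text \<open>The first hypothesis keeps the difference on the same side of the matrix entry, so the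
  second one applies to the same pair and the bounds chain.\<close>

lemma log_between_trans:
  "log_between A v y \<Longrightarrow> log_between A y z \<Longrightarrow> log_between A v z"
  unfolding log_between_def by (meson order_trans)

text \<open>Only differences enter, which allows normalising the coordinate at
  \<open>Min UNIV\<close> to 0.\<close>

lemma log_between_shift: "log_between A v (\<chi> i. y $ i - c) \<longleftrightarrow> log_between A v y"
  by (simp add: log_between_def)

section \<open>Reciprocal matrices and internal domination in logarithmic form\<close>

context
  fixes A :: "real^'n^'n"
  assumes A: "pairwise_comparison_matrix A"
begin

lemma pcm_pos: "A $ i $ j > 0"
  using A unfolding pairwise_comparison_matrix_def by blast

lemma pcm_ln_swap: "ln (A $ i $ j) = - ln (A $ j $ i)"
proof -
  have "A $ i $ j = 1 / A $ j $ i"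
    using A unfolding pairwise_comparison_matrix_def by blast
  then show ?thesis
    using pcm_pos[of j i] by (simp add: ln_div)
qed

lemma pcm_ln_diag: "ln (A $ i $ i) = 0"
  using pcm_ln_swap[of i i] by linarith

lemma log_between_rev:
  assumes "log_between A v y" "v $ i - v $ j \<le> ln (A $ i $ j)"
  shows "y $ i - y $ j \<le> ln (A $ i $ j)" "v $ i - v $ j \<le> y $ i - y $ j"
proof -
  have "ln (A $ j $ i) \<le> v $ j - v $ i"
    using assms(2) pcm_ln_swap[of i j] by linarith
  then have "ln (A $ j $ i) \<le> y $ j - y $ i \<and> y $ j - y $ i \<le> v $ j - v $ i"
    using assms(1) unfolding log_between_def by blast
  then show "y $ i - y $ j \<le> ln (A $ i $ j)" "v $ i - v $ j \<le> y $ i - y $ j"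
    using pcm_ln_swap[of i j] by linarith+
qed

lemma ratio_eq_exp:
  assumes "positive_vector w"
  shows "w $ i / w $ j = exp (ln_vec w $ i - ln_vec w $ j)"
  using assms by (simp add: positive_vector_def exp_diff)

text \<open>Both the entry and the ratio are values of the strictly increasing \<open>exp\<close>.
  Together with \<open>ratio_ratio_iff\<close> this translates every comparison of ratios into one
  of differences.\<close>

lemma entry_ratio_iff:
  assumes "positive_vector w"
  shows "A $ i $ j \<le> w $ i / w $ j \<longleftrightarrow> ln (A $ i $ j) \<le> ln_vec w $ i - ln_vec w $ j"
    and "w $ i / w $ j \<le> A $ i $ j \<longleftrightarrow> ln_vec w $ i - ln_vec w $ j \<le> ln (A $ i $ j)"
    and "A $ i $ j < w $ i / w $ j \<longleftrightarrow> ln (A $ i $ j) < ln_vec w $ i - ln_vec w $ j"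
    and "A $ i $ j = w $ i / w $ j \<longleftrightarrow> ln (A $ i $ j) = ln_vec w $ i - ln_vec w $ j"
proof -
  let ?r = "ln_vec w $ i - ln_vec w $ j"
  have "A $ i $ j = exp (ln (A $ i $ j))" "w $ i / w $ j = exp ?r"
    using pcm_pos ratio_eq_exp[OF assms] by simp_all
  then show "A $ i $ j \<le> w $ i / w $ j \<longleftrightarrow> ln (A $ i $ j) \<le> ?r"
    "w $ i / w $ j \<le> A $ i $ j \<longleftrightarrow> ?r \<le> ln (A $ i $ j)"
    "A $ i $ j < w $ i / w $ j \<longleftrightarrow> ln (A $ i $ j) < ?r"
    "A $ i $ j = w $ i / w $ j \<longleftrightarrow> ln (A $ i $ j) = ?r"
    by (metis exp_le_cancel_iff exp_less_cancel_iff exp_inj_iff)+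
qed

lemma ratio_ratio_iff:
  assumes "positive_vector w" "positive_vector u"
  shows "u $ i / u $ j \<le> w $ i / w $ j \<longleftrightarrow>
      ln_vec u $ i - ln_vec u $ j \<le> ln_vec w $ i - ln_vec w $ j"
    and "u $ i / u $ j < w $ i / w $ j \<longleftrightarrow>
      ln_vec u $ i - ln_vec u $ j < ln_vec w $ i - ln_vec w $ j"
  by (simp_all only: ratio_eq_exp[OF assms(1)] ratio_eq_exp[OF assms(2)]
      exp_le_cancel_iff exp_less_cancel_iff)

lemma dominates_internally_iff:
  assumes w: "positive_vector w" and u: "positive_vector u"
  shows "dominates_internally A u w \<longleftrightarrow> log_strictly_between A (ln_vec w) (ln_vec u)"
    (is "?L \<longleftrightarrow> ?R")
proof
  assume L: ?L
  then have b: "log_between A (ln_vec w) (ln_vec u)"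
    unfolding dominates_internally_def log_between_def
    by (simp only: entry_ratio_iff[OF w] entry_ratio_iff[OF u] ratio_ratio_iff[OF w u]) blast
  from L obtain k l where kl:
    "ln (A $ k $ l) \<le> ln_vec w $ k - ln_vec w $ l \<longrightarrow>
      ln_vec u $ k - ln_vec u $ l < ln_vec w $ k - ln_vec w $ l"
    "ln_vec w $ k - ln_vec w $ l \<le> ln (A $ k $ l) \<longrightarrow>
      ln_vec w $ k - ln_vec w $ l < ln_vec u $ k - ln_vec u $ l"
    unfolding dominates_internally_def
    by (simp only: entry_ratio_iff[OF w] ratio_ratio_iff[OF w u] ratio_ratio_iff[OF u w]) blast
  show ?R
  proof (cases "ln (A $ k $ l) < ln_vec w $ k - ln_vec w $ l")
    case True
    then show ?thesis using b kl unfolding log_strictly_between_def by (meson less_imp_le)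
  next
    \<comment> \<open>Equality of entry and ratio is impossible, since both implications in
      \<open>kl\<close> would then apply and contradict each other. So the ratio is below the entry
      and \<open>(l, k)\<close> is the required pair.\<close>
    case False
    then have "ln (A $ l $ k) < ln_vec w $ l - ln_vec w $ k"
      "ln_vec u $ l - ln_vec u $ k < ln_vec w $ l - ln_vec w $ k"
      using kl pcm_ln_swap[of l k] by linarith+
    then show ?thesis using b unfolding log_strictly_between_def by blast
  qed
next
  assume R: ?R
  then have b: "log_between A (ln_vec w) (ln_vec u)"
    by (simp add: log_strictly_between_def)
  from R obtain k l where "ln (A $ k $ l) < ln_vec w $ k - ln_vec w $ l"
      "ln_vec u $ k - ln_vec u $ l < ln_vec w $ k - ln_vec w $ l"
    unfolding log_strictly_between_def by blast
  \<comment> \<open>The pair lies strictly above its entry, so the second implication is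
    vacuous.\<close>
  then have ex: "\<exists>k l.
    (ln (A $ k $ l) \<le> ln_vec w $ k - ln_vec w $ l \<longrightarrow>
      ln_vec u $ k - ln_vec u $ l < ln_vec w $ k - ln_vec w $ l) \<and>
    (ln_vec w $ k - ln_vec w $ l \<le> ln (A $ k $ l) \<longrightarrow>
      ln_vec w $ k - ln_vec w $ l < ln_vec u $ k - ln_vec u $ l)"
    by (meson not_less)
  have "\<forall>i j. (ln (A $ i $ j) \<le> ln_vec w $ i - ln_vec w $ j \<longrightarrow>
      ln (A $ i $ j) \<le> ln_vec u $ i - ln_vec u $ j \<and>
      ln_vec u $ i - ln_vec u $ j \<le> ln_vec w $ i - ln_vec w $ j) \<and>
    (ln_vec w $ i - ln_vec w $ j \<le> ln (A $ i $ j) \<longrightarrow>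
      ln_vec u $ i - ln_vec u $ j \<le> ln (A $ i $ j) \<and>
      ln_vec w $ i - ln_vec w $ j \<le> ln_vec u $ i - ln_vec u $ j)"
    using b log_between_rev[OF b] unfolding log_between_def by blast
  with u ex show ?L
    unfolding dominates_internally_def
    by (simp only: entry_ratio_iff[OF w] entry_ratio_iff[OF u] ratio_ratio_iff[OF w u]
        ratio_ratio_iff[OF u w])
qed

section \<open>Efficiency as the absence of internal dominators\<close>

text \<open>A ratio moving towards its entry without passing it gets no farther from it, and
  strictly nearer where the movement is strict.\<close>

lemma dominates_if_internally:
  assumes "dominates_internally A u w"
  shows "dominates A u w"
proof -
  have i: "(A $ i $ j \<le> w $ i / w $ j \<longrightarrow>
           A $ i $ j \<le> u $ i / u $ j \<and> u $ i / u $ j \<le> w $ i / w $ j) \<and>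
        (A $ i $ j \<ge> w $ i / w $ j \<longrightarrow>
           A $ i $ j \<ge> u $ i / u $ j \<and> u $ i / u $ j \<ge> w $ i / w $ j)" for i j
    using assms unfolding dominates_internally_def by blast
  have le: "\<bar>A $ i $ j - u $ i / u $ j\<bar> \<le> \<bar>A $ i $ j - w $ i / w $ j\<bar>" for i j
    using i[of i j] by linarith
  obtain k l where
    "(A $ k $ l \<le> w $ k / w $ l \<longrightarrow> u $ k / u $ l < w $ k / w $ l) \<and>
     (A $ k $ l \<ge> w $ k / w $ l \<longrightarrow> u $ k / u $ l > w $ k / w $ l)"
    using assms unfolding dominates_internally_def by blast
  then have "\<bar>A $ k $ l - u $ k / u $ l\<bar> < \<bar>A $ k $ l - w $ k / w $ l\<bar>"
    using i[of k l] by linarith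
  with le show ?thesis unfolding dominates_def by blast
qed

lemma dominates_imp_log_strictly_between:
  assumes w: "positive_vector w" and u: "positive_vector u" and dom: "dominates A u w"
  shows "\<exists>y. log_strictly_between A (ln_vec w) y"
proof -
  define v where "v = ln_vec w"
  define x where "x = ln_vec u"
  \<comment> \<open>The segment from \<open>v\<close> at t = 0 to \<open>x\<close> at t = 1. Since
    \<open>x\<close> may overshoot the entries, a small t is chosen below; differences are affine in
    t.\<close>
  define p where "p t = v + t *\<^sub>R (x - v)" for t :: real
  have p: "p t $ i - p t $ j = (v $ i - v $ j) + t * ((x $ i - x $ j) - (v $ i - v $ j))" for t i j
    by (simp add: p_def algebra_simps)
  have dle: "\<bar>A $ i $ j - u $ i / u $ j\<bar> \<le> \<bar>A $ i $ j - w $ i / w $ j\<bar>" for i j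
    using dom unfolding dominates_def by blast
  \<comment> \<open>The error of \<open>w\<close> vanishes at a tie, hence so does that of
    \<open>u\<close>.\<close>
  have tie: "x $ i - x $ j = v $ i - v $ j" if "ln (A $ i $ j) = v $ i - v $ j" for i j
  proof -
    have "A $ i $ j = w $ i / w $ j"
      using that entry_ratio_iff(4)[OF w] by (simp add: v_def)
    moreover from this have "A $ i $ j = u $ i / u $ j"
      using dle[of i j] by simp
    ultimately show ?thesis
      using entry_ratio_iff(4)[OF w] entry_ratio_iff(4)[OF u]
      unfolding v_def x_def by metis
  qed
  \<comment> \<open>If the ratio already exceeds its entry, increasing it would increase the
    error.\<close>
  have above: "x $ i - x $ j \<le> v $ i - v $ j" if "ln (A $ i $ j) < v $ i - v $ j" for i j
  proof -
    have "A $ i $ j < w $ i / w $ j"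
      using that entry_ratio_iff(3)[OF w] by (simp add: v_def)
    then have "u $ i / u $ j \<le> w $ i / w $ j"
      using dle[of i j] by linarith
    then show ?thesis
      using ratio_ratio_iff(1)[OF w u] unfolding v_def x_def by blast
  qed
  have "\<forall>\<^sub>F t in at_right 0. ln (A $ i $ j) < v $ i - v $ j \<longrightarrow> ln (A $ i $ j) < p t $ i - p t $ j"
    for i j
  proof (cases "ln (A $ i $ j) < v $ i - v $ j")
    case True
    have "((\<lambda>t. p t $ i - p t $ j) \<longlongrightarrow>
        (v $ i - v $ j) + 0 * ((x $ i - x $ j) - (v $ i - v $ j))) (at_right 0)"
      unfolding p by (intro tendsto_intros)
    then have "\<forall>\<^sub>F t in at_right 0. ln (A $ i $ j) < p t $ i - p t $ j"
      using True by (intro order_tendstoD(1)) auto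
    then show ?thesis by eventually_elim simp
  qed simp
  then have "\<forall>\<^sub>F t in at_right (0::real). t > 0 \<and> (\<forall>i j.
      ln (A $ i $ j) < v $ i - v $ j \<longrightarrow> ln (A $ i $ j) < p t $ i - p t $ j)"
    by (intro eventually_conj eventually_at_right_less eventually_all_finite)
  \<comment> \<open>Strict inequalities at t = 0 persist for small positive t by continuity, and as
    there are finitely many pairs, one t serves them all.\<close>
  then obtain t :: real where t: "t > 0" and
    near: "\<And>i j. ln (A $ i $ j) < v $ i - v $ j \<Longrightarrow> ln (A $ i $ j) < p t $ i - p t $ j"
    using eventually_happens'[OF trivial_limit_at_right_real] by blast
  have "log_between A v (p t)"
    unfolding log_between_def
  proof (intro allI impI)
    fix i j
    assume "ln (A $ i $ j) \<le> v $ i - v $ j"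
    then consider "ln (A $ i $ j) = v $ i - v $ j" | "ln (A $ i $ j) < v $ i - v $ j"
      by linarith
    then show "ln (A $ i $ j) \<le> p t $ i - p t $ j \<and> p t $ i - p t $ j \<le> v $ i - v $ j"
    proof cases
      case 1
      then show ?thesis using tie[OF 1] by (simp add: p)
    next
      case 2
      have "t * ((x $ i - x $ j) - (v $ i - v $ j)) \<le> 0"
        using t above[OF 2] by (simp add: mult_le_0_iff)
      then show ?thesis using near[OF 2] p[of t i j] by linarith
    qed
  qed
  moreover have "\<exists>k l. ln (A $ k $ l) < v $ k - v $ l \<and> p t $ k - p t $ l < v $ k - v $ l"
  proof -
    obtain k l where kl: "\<bar>A $ k $ l - u $ k / u $ l\<bar> < \<bar>A $ k $ l - w $ k / w $ l\<bar>"
      using dom unfolding dominates_def by blast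
    have strict: "\<exists>k l. ln (A $ k $ l) < v $ k - v $ l \<and> x $ k - x $ l < v $ k - v $ l"
    proof (cases "A $ k $ l < w $ k / w $ l")
      case True
      then have "u $ k / u $ l < w $ k / w $ l" using kl by linarith
      then show ?thesis
        using True entry_ratio_iff(3)[OF w] ratio_ratio_iff(2)[OF w u]
        unfolding v_def x_def by blast
    next
      case False
      then have "w $ k / w $ l < u $ k / u $ l" "w $ k / w $ l \<le> A $ k $ l"
        "A $ k $ l \<noteq> w $ k / w $ l"
        using kl by auto
      then have "v $ k - v $ l < x $ k - x $ l" "v $ k - v $ l \<le> ln (A $ k $ l)"
        "ln (A $ k $ l) \<noteq> v $ k - v $ l"
        using entry_ratio_iff[OF w] ratio_ratio_iff(2)[OF u w]
        unfolding v_def x_def by blast+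
      then have "ln (A $ l $ k) < v $ l - v $ k \<and> x $ l - x $ k < v $ l - v $ k"
        using pcm_ln_swap[of l k] by linarith
      then show ?thesis by blast
    qed
    then obtain k l where "ln (A $ k $ l) < v $ k - v $ l" "x $ k - x $ l < v $ k - v $ l"
      by blast
    moreover from this t have "t * ((x $ k - x $ l) - (v $ k - v $ l)) < 0"
      by (simp add: mult_less_0_iff)
    ultimately show ?thesis using p[of t k l]
      by (intro exI[of _ k] exI[of _ l]) linarith
  qed
  ultimately have "log_strictly_between A v (p t)"
    unfolding log_strictly_between_def by (rule conjI)
  then show ?thesis unfolding v_def ..
qed

text \<open>A strictly intermediate \<open>y\<close> exponentiates to an internal dominator, hence
  to a dominator; conversely any dominator yields such a \<open>y\<close>. Efficiency thus becomes a
  statement about the differences that the linear program constrains.\<close>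

lemma efficient_iff:
  assumes w: "positive_vector w"
  shows "efficient A w \<longleftrightarrow> (\<nexists>y. log_strictly_between A (ln_vec w) y)"
proof
  assume "efficient A w"
  show "\<nexists>y. log_strictly_between A (ln_vec w) y"
  proof
    assume "\<exists>y. log_strictly_between A (ln_vec w) y"
    then obtain y where "log_strictly_between A (ln_vec w) y" ..
    then have "dominates_internally A (exp_vec y) w"
      unfolding dominates_internally_iff[OF w positive_exp_vec] ln_exp_vec .
    from dominates_if_internally[OF this] \<open>efficient A w\<close> positive_exp_vec[of y] show False
      unfolding efficient_def by blast
  qed
next
  assume "\<nexists>y. log_strictly_between A (ln_vec w) y"
  with w dominates_imp_log_strictly_between[OF w] show "efficient A w"
    unfolding efficient_def by blast
qed

end

section \<open>Feasible points of the linear program\<close>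

context
  fixes A :: "real^('n::{finite,linorder})^('n::{finite,linorder})"
    and w :: "real^('n::{finite,linorder})"
  assumes A: "pairwise_comparison_matrix A" and w: "positive_vector w"
begin

private lemma above_iff: "(i, j) \<in> above_set A w \<longleftrightarrow> ln (A $ i $ j) < ln_vec w $ i - ln_vec w $ j"
  using entry_ratio_iff(3)[OF A w] by (simp add: above_set_def)

private lemma tie_iff:
  "(i, j) \<in> tie_set A w \<longleftrightarrow> ln (A $ i $ j) = ln_vec w $ i - ln_vec w $ j \<and> i < j"
  using entry_ratio_iff(4)[OF A w] by (simp add: tie_set_def)

text \<open>The constraints on \<open>y\<close> list each condition of \<open>log_between\<close>
  once, and reciprocity supplies the missing pairs. What remains for \<open>s\<close> is to lie
  between 0 and the drop of the difference.\<close>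

lemma lp_feasible_iff:
  "lp_feasible A w y s \<longleftrightarrow> log_between A (ln_vec w) y \<and> y $ Min UNIV = 0 \<and>
     (\<forall>(i, j) \<in> above_set A w. 0 \<le> s i j \<and> s i j \<le> (ln_vec w $ i - ln_vec w $ j) - (y $ i - y $ j))"
    (is "?L \<longleftrightarrow> ?R")
proof
  assume L: ?L
  have above: "ln (A $ i $ j) \<le> y $ i - y $ j \<and> 0 \<le> s i j \<and>
      s i j \<le> (ln_vec w $ i - ln_vec w $ j) - (y $ i - y $ j)" if "(i, j) \<in> above_set A w" for i j
  proof -
    from L that have "y $ j - y $ i \<le> - ln (A $ i $ j)"
      "y $ i - y $ j + s i j \<le> ln (w $ i) - ln (w $ j)" "s i j \<ge> 0"
      unfolding lp_feasible_def by blast+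
    then show ?thesis by simp
  qed
  have tie: "y $ i - y $ j = ln (A $ i $ j)" if "(i, j) \<in> tie_set A w" for i j
    using L that unfolding lp_feasible_def by blast
  have "log_between A (ln_vec w) y"
    unfolding log_between_def
  proof (intro allI impI)
    fix i j
    assume "ln (A $ i $ j) \<le> ln_vec w $ i - ln_vec w $ j"
    \<comment> \<open>Since \<open>tie_set\<close> keeps only i < j, diagonal pairs and reversed
      ties are separate cases.\<close>
    then consider "(i, j) \<in> above_set A w" | "i = j" |
        "i < j" "ln (A $ i $ j) = ln_vec w $ i - ln_vec w $ j" |
        "j < i" "ln (A $ i $ j) = ln_vec w $ i - ln_vec w $ j"
      unfolding above_iff by (metis less_le not_less)
    then show "ln (A $ i $ j) \<le> y $ i - y $ j \<and> y $ i - y $ j \<le> ln_vec w $ i - ln_vec w $ j"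
    proof cases
      case 1
      show ?thesis using above[OF 1] by linarith
    next
      case 2
      then show ?thesis by (simp add: pcm_ln_diag[OF A])
    next
      case 3
      then show ?thesis using tie[of i j] unfolding tie_iff by linarith
    next
      case 4
      then show ?thesis
        using tie[of j i] pcm_ln_swap[OF A, of i j] unfolding tie_iff by linarith
    qed
  qed
  with above L show ?R unfolding lp_feasible_def by blast
next
  assume R: ?R
  then have b: "log_between A (ln_vec w) y" by blast
  have "ln (A $ i $ j) \<le> y $ i - y $ j" if "(i, j) \<in> above_set A w" for i j
    using that b unfolding above_iff log_between_def by (meson less_imp_le)
  moreover have "y $ i - y $ j = ln (A $ i $ j)" if "(i, j) \<in> tie_set A w" for i j
  proof -
    have e: "ln (A $ i $ j) = ln_vec w $ i - ln_vec w $ j"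
      using that unfolding tie_iff by blast
    then have "ln (A $ i $ j) \<le> y $ i - y $ j" "y $ i - y $ j \<le> ln_vec w $ i - ln_vec w $ j"
      using b unfolding log_between_def by (metis order_refl)+
    with e show ?thesis by linarith
  qed
  ultimately show ?L
    using R unfolding lp_feasible_def by (fastforce simp: algebra_simps)
qed

text \<open>The largest \<open>s\<close> admissible for a given \<open>y\<close>, hence the best
  one; it reduces the minimisation to \<open>y\<close> alone.\<close>

definition full_slack :: "real^('n::{finite,linorder}) \<Rightarrow> 'n \<Rightarrow> 'n \<Rightarrow> real" where
  "full_slack y i j = (ln_vec w $ i - ln_vec w $ j) - (y $ i - y $ j)"

lemma lp_feasible_full_slack:
  "log_between A (ln_vec w) y \<Longrightarrow> y $ Min UNIV = 0 \<Longrightarrow> lp_feasible A w y (full_slack y)"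
  unfolding lp_feasible_iff above_iff full_slack_def log_between_def
  by (auto simp: above_iff)

lemma lp_objective_full_slack_le:
  assumes "lp_feasible A w y s"
  shows "lp_objective A w (full_slack y) \<le> lp_objective A w s"
  using assms unfolding lp_objective_def lp_feasible_iff full_slack_def
  by (intro sum_mono) auto

lemma lp_objective_nonpos:
  assumes "lp_feasible A w y s"
  shows "lp_objective A w s \<le> 0"
  using assms unfolding lp_objective_def lp_feasible_iff
  by (intro sum_nonpos) auto

section \<open>Existence of an optimal solution\<close>

lemma compact_log_between: "compact {y. log_between A (ln_vec w) y \<and> y $ Min UNIV = 0}"
  (is "compact ?K")
proof -
  let ?m = "Min UNIV :: 'n"
  \<comment> \<open>The premise does not depend on \<open>y\<close>, so each set is a closed slab or
    the whole space.\<close>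
  have "closed {y :: real^('n::{finite,linorder}). ln (A $ i $ j) \<le> ln_vec w $ i - ln_vec w $ j \<longrightarrow>
      ln (A $ i $ j) \<le> y $ i - y $ j \<and> y $ i - y $ j \<le> ln_vec w $ i - ln_vec w $ j}" for i j
    by (intro closed_Collect_imp closed_Collect_conj closed_Collect_le continuous_intros
        open_Collect_const)
  then have "closed ?K"
    unfolding log_between_def
    by (intro closed_Collect_conj closed_Collect_all closed_Collect_eq continuous_intros)
  moreover have "bounded ?K"
  proof (rule boundedI)
    fix y
    assume "y \<in> ?K"
    then have b: "log_between A (ln_vec w) y" and m: "y $ ?m = 0" by auto
    \<comment> \<open>As \<open>y $ ?m = 0\<close>, the coordinate \<open>y $ i\<close> is itself a
      difference, trapped between two constants.\<close>
    have "\<bar>y $ i\<bar> \<le> \<bar>ln (A $ i $ ?m)\<bar> + \<bar>ln_vec w $ i - ln_vec w $ ?m\<bar>" for i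
    proof (cases "ln (A $ i $ ?m) \<le> ln_vec w $ i - ln_vec w $ ?m")
      case True
      then have "ln (A $ i $ ?m) \<le> y $ i - y $ ?m \<and> y $ i - y $ ?m \<le> ln_vec w $ i - ln_vec w $ ?m"
        using b unfolding log_between_def by blast
      with m show ?thesis by linarith
    next
      case False
      then have "ln_vec w $ i - ln_vec w $ ?m \<le> ln (A $ i $ ?m)" by linarith
      from log_between_rev[OF A b this] m show ?thesis by linarith
    qed
    then have "(\<Sum>i\<in>UNIV. \<bar>y $ i\<bar>)
        \<le> (\<Sum>i\<in>UNIV. \<bar>ln (A $ i $ ?m)\<bar> + \<bar>ln_vec w $ i - ln_vec w $ ?m\<bar>)"
      by (intro sum_mono)
    with norm_le_l1_cart[of y]
    show "norm y \<le> (\<Sum>i\<in>UNIV. \<bar>ln (A $ i $ ?m)\<bar> + \<bar>ln_vec w $ i - ln_vec w $ ?m\<bar>)"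
      by linarith
  qed
  ultimately show ?thesis by (simp add: compact_eq_bounded_closed)
qed

text \<open>With full slack the objective is a continuous function of \<open>y\<close> on a compact
  set, so it attains a minimum there; any other choice of \<open>s\<close> does no better.\<close>

lemma lp_optimal_solution_exists: "\<exists>y s. lp_optimal_solution A w y s"
proof -
  let ?K = "{y. log_between A (ln_vec w) y \<and> y $ Min UNIV = 0}"
  \<comment> \<open>The normalised logarithm of \<open>w\<close> shows that the set is
    nonempty.\<close>
  have "(\<chi> i. ln_vec w $ i - ln_vec w $ Min UNIV) \<in> ?K"
    by (simp add: log_between_def)
  moreover have "continuous_on ?K (\<lambda>y. lp_objective A w (full_slack y))"
    unfolding lp_objective_def full_slack_def case_prod_beta by (intro continuous_intros)
  ultimately obtain y where y: "y \<in> ?K" and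
    min: "\<And>z. z \<in> ?K \<Longrightarrow> lp_objective A w (full_slack y) \<le> lp_objective A w (full_slack z)"
    using continuous_attains_inf[OF compact_log_between, of "\<lambda>y. lp_objective A w (full_slack y)"]
    by blast
  have "lp_objective A w (full_slack y) \<le> lp_objective A w s" if "lp_feasible A w z s" for z s
    using that min[of z] lp_objective_full_slack_le[OF that] lp_feasible_iff by force
  with y have "lp_optimal_solution A w y (full_slack y)"
    unfolding lp_optimal_solution_def using lp_feasible_full_slack by blast
  then show ?thesis by blast
qed

section \<open>The optimum value and its link with efficiency\<close>

lemma lp_optimum_eq:
  assumes "lp_optimal_solution A w y s"
  shows "lp_optimum A w = lp_objective A w s"
  unfolding lp_optimum_def
  using assms unfolding lp_optimal_solution_def by (intro cInf_eq_minimum) blast+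

text \<open>By transitivity \<open>z\<close>, once normalised, is feasible; compared with
  \<open>y\<close> its full slack is nowhere smaller and somewhere larger. The case
  \<open>y = ln_vec w\<close> gives the criterion for the value 0, the case of an optimal
  \<open>y\<close> the efficiency of its exponential.\<close>

lemma lp_feasible_better:
  assumes y: "log_between A (ln_vec w) y" and z: "log_strictly_between A y z"
  shows "\<exists>z' s. lp_feasible A w z' s \<and> lp_objective A w s < lp_objective A w (full_slack y)"
proof -
  define z' where "z' = (\<chi> i. z $ i - z $ Min UNIV)"
  have "log_between A y z" using z by (simp add: log_strictly_between_def)
  with y have b: "log_between A (ln_vec w) z" by (rule log_between_trans)
  then have "lp_feasible A w z' (full_slack z')"
    by (intro lp_feasible_full_slack) (simp_all add: z'_def log_between_shift)
  moreover have "lp_objective A w (full_slack z') < lp_objective A w (full_slack y)"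
    unfolding lp_objective_def
  proof (rule sum_strict_mono_ex1)
    have "z $ i - z $ j \<le> y $ i - y $ j" if "(i, j) \<in> above_set A w" for i j
      using that y \<open>log_between A y z\<close> unfolding above_iff log_between_def by (meson less_imp_le)
    then show "\<forall>p\<in>above_set A w.
        (case p of (i, j) \<Rightarrow> - full_slack z' i j) \<le> (case p of (i, j) \<Rightarrow> - full_slack y i j)"
      by (force simp: full_slack_def z'_def)
    obtain k l where kl: "ln (A $ k $ l) < y $ k - y $ l" "z $ k - z $ l < y $ k - y $ l"
      using z unfolding log_strictly_between_def by blast
    \<comment> \<open>Otherwise the difference of \<open>v\<close> would be at most the entry, and
      betweenness would keep that of \<open>y\<close> there too, against
      \<open>kl(1)\<close>.\<close>
    have "(k, l) \<in> above_set A w"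
      using kl(1) log_between_rev(1)[OF A y, of k l] unfolding above_iff by linarith
    with kl(2) show "\<exists>p\<in>above_set A w.
        (case p of (i, j) \<Rightarrow> - full_slack z' i j) < (case p of (i, j) \<Rightarrow> - full_slack y i j)"
      by (force simp: full_slack_def z'_def)
  qed simp
  ultimately show ?thesis by blast
qed

text \<open>A negative objective needs some positive \<open>s k l\<close>, and the slack constraint
  turns it into a strict drop at \<open>(k, l)\<close>.\<close>

lemma log_strictly_between_if_objective_neg:
  assumes f: "lp_feasible A w y s" and neg: "lp_objective A w s < 0"
  shows "log_strictly_between A (ln_vec w) y"
proof -
  have "\<exists>(i, j) \<in> above_set A w. s i j > 0"
  proof (rule ccontr)
    assume "\<not> ?thesis"
    then have "lp_objective A w s \<ge> 0"
      unfolding lp_objective_def by (intro sum_nonneg) force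
    with neg show False by simp
  qed
  then obtain k l where kl: "(k, l) \<in> above_set A w" "s k l > 0" by blast
  with f have "s k l \<le> (ln_vec w $ k - ln_vec w $ l) - (y $ k - y $ l)"
    unfolding lp_feasible_iff by blast
  with kl(2) have "y $ k - y $ l < ln_vec w $ k - ln_vec w $ l" by linarith
  with kl(1) f show ?thesis
    unfolding log_strictly_between_def lp_feasible_iff above_iff by blast
qed

lemma lp_objective_full_slack_self: "lp_objective A w (full_slack (ln_vec w)) = 0"
  by (simp add: lp_objective_def full_slack_def case_prod_beta)

lemma optimal_objective_zero_iff:
  assumes opt: "lp_optimal_solution A w y s"
  shows "lp_objective A w s = 0 \<longleftrightarrow> efficient A w"
proof -
  have f: "lp_feasible A w y s" using opt by (simp add: lp_optimal_solution_def)
  have "lp_objective A w s < 0" if "log_strictly_between A (ln_vec w) z" for z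
  proof -
    \<comment> \<open>The improvement starts from \<open>ln_vec w\<close>, whose full slack has
      objective 0, so the improved value is negative.\<close>
    have "log_between A (ln_vec w) (ln_vec w)" by (simp add: log_between_def)
    from lp_feasible_better[OF this that] obtain z' s' where
      "lp_feasible A w z' s'" "lp_objective A w s' < 0"
      by (auto simp: lp_objective_full_slack_self)
    with opt show ?thesis unfolding lp_optimal_solution_def by fastforce
  qed
  then show ?thesis
    using lp_objective_nonpos[OF f] log_strictly_between_if_objective_neg[OF f]
      efficient_iff[OF A w] by fastforce
qed

text \<open>A \<open>z\<close> strictly between \<open>y\<close> and the entries would give a
  feasible point with objective below that of \<open>full_slack y\<close>, hence below the
  optimum.\<close>

lemma efficient_exp_optimal:
  assumes opt: "lp_optimal_solution A w y s"
  shows "efficient A (exp_vec y)"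
proof -
  have f: "lp_feasible A w y s" using opt by (simp add: lp_optimal_solution_def)
  then have y: "log_between A (ln_vec w) y" by (simp add: lp_feasible_iff)
  have "\<not> log_strictly_between A y z" for z
  proof
    assume "log_strictly_between A y z"
    from lp_feasible_better[OF y this] obtain z' s' where
      "lp_feasible A w z' s'" "lp_objective A w s' < lp_objective A w (full_slack y)" by blast
    with lp_objective_full_slack_le[OF f] opt show False
      unfolding lp_optimal_solution_def by fastforce
  qed
  then show ?thesis by (simp add: efficient_iff[OF A])
qed

text \<open>Inefficiency makes the optimal value nonzero, hence negative, so \<open>y\<close> has
  moved strictly away from \<open>ln_vec w\<close>.\<close>

lemma dominates_internally_exp_optimal:
  assumes opt: "lp_optimal_solution A w y s" and "\<not> efficient A w"
  shows "dominates_internally A (exp_vec y) w"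
proof -
  have f: "lp_feasible A w y s" using opt by (simp add: lp_optimal_solution_def)
  have "lp_objective A w s < 0"
    using optimal_objective_zero_iff[OF opt] assms(2) lp_objective_nonpos[OF f] by linarith
  then have "log_strictly_between A (ln_vec w) y"
    by (rule log_strictly_between_if_objective_neg[OF f])
  then show ?thesis by (simp add: dominates_internally_iff[OF A w])
qed

end

theorem theorem4p1:
  fixes A :: "real^('n::{finite,linorder})^('n::{finite,linorder})"
    and w :: "real^('n::{finite,linorder})"
  assumes "pairwise_comparison_matrix A"
    and "positive_vector w"
    and "above_set A w \<noteq> {}"
  shows "(\<exists>y s. lp_optimal_solution A w y s) \<and>
    lp_optimum A w \<le> 0 \<and>
    (lp_optimum A w = 0 \<longleftrightarrow> efficient A w) \<and>
    (\<forall>y s. lp_optimal_solution A w y s \<longrightarrow> inefficient A w \<longrightarrow>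
       efficient A (\<chi> i. exp (y $ i)) \<and>
       dominates_internally A (\<chi> i. exp (y $ i)) w)"
proof -
  note Aw = assms(1,2)
  \<comment> \<open>Attainment comes first: it makes the \<open>Inf\<close> in
    \<open>lp_optimum\<close> a genuine minimum.\<close>
  obtain y s where opt: "lp_optimal_solution A w y s"
    using lp_optimal_solution_exists[OF Aw] by blast
  then have "lp_feasible A w y s" by (simp add: lp_optimal_solution_def)
  from lp_objective_nonpos[OF Aw this] have "lp_optimum A w \<le> 0"
    by (simp add: lp_optimum_eq[OF Aw opt])
  moreover have "lp_optimum A w = 0 \<longleftrightarrow> efficient A w"
    using optimal_objective_zero_iff[OF Aw opt] by (simp add: lp_optimum_eq[OF Aw opt])
  moreover have "efficient A (\<chi> i. exp (y $ i)) \<and> dominates_internally A (\<chi> i. exp (y $ i)) w"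
    if "lp_optimal_solution A w y s" "inefficient A w" for y s
    using that efficient_exp_optimal[OF Aw] dominates_internally_exp_optimal[OF Aw]
    unfolding inefficient_def exp_vec_def by blast
  ultimately show ?thesis using opt by blast
qed

end
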